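(* Let $(X,d_X)=(\{x_0,x_1,\dots,x_n\},d_X)$ be a nondegenerate finite ultrametric space with $|X|=n+1\geq 3$ (the points $x_0,\dots,x_n$ being distinct), and let $\alpha_1>0$ be the minimum nonzero distance in $X$. Then for any $p>0$ the smallest eigenvalue of the $p$-Gramian $G_p=G_p(X)$ is $\lambda_{\min}(G_p)=\alpha_1^p/2$.
   Context: A metric space $(X,d_X)$ is an ultrametric space if $d_X(x,y)\leq\max\{d_X(x,z),d_X(y,z)\}$ for all $x,y,z\in X$. The $p$-Gramian of $(X,d_X)=(\{x_0,x_1,\dots,x_n\},d_X)$ is the real symmetric $n\times n$ matrix $G_p(X)=(g_{ij})_{i,j=1}^n$ with $g_{ij}=\frac12\left(d_X(x_i,x_0)^p+d_X(x_j,x_0)^p-d_X(x_i,x_j)^p\right)$. It depends on the choice of the base point $x_0$ and on the labelling of the points. Its minimum eigenvalue is denoted $\lambda_{\min}(G_p)$. Let $X$ be a finite ultrametric space with minimum nonzero distance $\alpha_1$. For $z\in X$, the set $B_z(\alpha_1)=\{x\in X: d_X(x,z)\leq\alpha_1\}$ is called a coterie in $X$ if $|B_z(\alpha_1)|>1$. The (labelled) finite ultrametric space $X=\{x_0,\dots,x_n\}$ is called degenerate if there is exactly one coterie $B\subseteq X$ and $|B|=2$ and $x_0\in B$. Otherwise it is called nondegenerate. *)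

theory Defs
  imports
    "HOL-Analysis.Abstract_Metric_Spaces"
    "Jordan_Normal_Form.Spectral_Radius"
begin

locale Ultrametric_space = Metric_space +
  assumes ultrametric:
    "\<And>x y z. \<lbrakk>x \<in> M; y \<in> M; z \<in> M\<rbrakk> \<Longrightarrow> d x y \<le> max (d x z) (d y z)"

text \<open>A labelled finite space $\{x_0,\dots,x_n\}$ is given by a map
  \<open>x :: nat \<Rightarrow> 'a\<close>, injective on \<open>{..n}\<close>, and its underlying set is
  \<open>x ` {..n}\<close>; the base point is \<open>x 0\<close>. Only the values \<open>x 0, \<dots>, x n\<close> matter.\<close>

text \<open>Matrices are indexed from 0, so entry \<open>(i, j)\<close> belongs to the pair of
  points \<open>x (i + 1), x (j + 1)\<close>.  On the diagonal \<open>0 powr p = 0\<close>.\<close>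

definition gramian :: "real \<Rightarrow> ('a \<Rightarrow> 'a \<Rightarrow> real) \<Rightarrow> nat \<Rightarrow> (nat \<Rightarrow> 'a) \<Rightarrow> real mat" where
  "gramian p d n x = mat n n (\<lambda>(i, j).
     (d (x (i + 1)) (x 0) powr p + d (x (j + 1)) (x 0) powr p
        - d (x (i + 1)) (x (j + 1)) powr p) / 2)"

text \<open>Meaningful for real symmetric matrices of positive dimension: their
  (real) spectrum is finite and nonempty.\<close>

definition min_eigenvalue :: "real mat \<Rightarrow> real" where
  "min_eigenvalue A = Min (spectrum A)"

text \<open>Meaningful for finite spaces with at least two points.\<close>

definition min_dist :: "'a set \<Rightarrow> ('a \<Rightarrow> 'a \<Rightarrow> real) \<Rightarrow> real" where
  "min_dist M d = Min {d x y | x y. x \<in> M \<and> y \<in> M \<and> d x y \<noteq> 0}"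

definition coterie :: "'a set \<Rightarrow> ('a \<Rightarrow> 'a \<Rightarrow> real) \<Rightarrow> 'a set \<Rightarrow> bool" where
  "coterie M d B \<longleftrightarrow>
     (\<exists>z\<in>M. B = Metric_space.mcball M d z (min_dist M d)) \<and> card B > 1"

definition degenerate :: "('a \<Rightarrow> 'a \<Rightarrow> real) \<Rightarrow> nat \<Rightarrow> (nat \<Rightarrow> 'a) \<Rightarrow> bool" where
  "degenerate d n x \<longleftrightarrow>
     (\<exists>B. {C. coterie (x ` {..n}) d C} = {B} \<and> card B = 2 \<and> x 0 \<in> B)"

end

theory Submission
  imports Defs
begin

text \<open>
  Write \<open>D i j = d (x i) (x j) powr p\<close>, which is again an ultrametric, and \<open>m\<close> for the
  smallest distance between distinct points.  Extending \<open>v \<in> \<real>\<^sup>n\<close> by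
  \<open>w 0 = - (\<Sum>i<n. v $ i)\<close> to a vector \<open>w\<close> of sum zero on all \<open>n + 1\<close> points turns the quadratic
  form of the Gramian into \<open>- (\<Sum>i\<le>n. \<Sum>j\<le>n. D i j * w i * w j) / 2\<close>
  (\<open>double_sum_gramian_form\<close>), which makes no reference to the base point.

  For the lower bound, an ultrametric is of strict negative type with an explicit gap: on vectors
  \<open>w\<close> of sum zero the form of \<open>D\<close> is at most \<open>- (m powr p) * (\<Sum>i\<le>n. (w i)\<^sup>2)\<close>
  (\<open>ultrametric_quadratic_form_le\<close>).  Since \<open>w\<close> extends \<open>v\<close>, each
  eigenvalue of the Gramian is at least \<open>m powr p / 2\<close> (\<open>gramian_eigenvalue_ge\<close>).

  This bound is an eigenvalue as soon as two points other than the base point are at distance \<open>m\<close>: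
  the two points of a closest pair are equidistant from any third point, so the difference of the
  corresponding unit vectors is an eigenvector (\<open>closest_pair_gramian_eigenvalue\<close>).  Such
  a pair is missing exactly in the degenerate case: if each closest pair contains the base point,
  then, again by the ultrametric inequality, there is only one closest pair, and it is the only
  coterie (\<open>unique_coterie\<close>).
\<close>

(* With this, v $ i is the entry of a vector whose dimension is not part of its type. *)
unbundle no vec_syntax

section \<open>Ultrametric matrices on vectors of sum zero\<close>

text \<open>
  The two points \<open>a\<close>, \<open>b\<close> of a closest pair have the same distances to all other points, so the form
  does not change, apart from the term \<open>2 * D a b * v a * v b\<close>, when the mass of \<open>a\<close> is moved
  to \<open>b\<close> and \<open>a\<close> is deleted.  The right-hand side changes by the same term, because
  \<open>(v a + v b)\<^sup>2 = (v a)\<^sup>2 + (v b)\<^sup>2 + 2 * v a * v b\<close>; hence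
  the inequality carries over by induction on the number of points.  The sum of squares is included
  in the claim for the sake of this cancellation: a bound by \<open>0\<close> alone would leave the
  term \<open>2 * D a b * v a * v b\<close>, whose sign is unknown.
\<close>
lemma ultrametric_quadratic_form_le:
  fixes D :: "'b \<Rightarrow> 'b \<Rightarrow> real" and v :: "'b \<Rightarrow> real"
  assumes "finite S"
    and diag: "\<And>i. i \<in> S \<Longrightarrow> D i i = 0"
    and sym: "\<And>i j. i \<in> S \<Longrightarrow> j \<in> S \<Longrightarrow> D i j = D j i"
    and ultra: "\<And>i j k. i \<in> S \<Longrightarrow> j \<in> S \<Longrightarrow> k \<in> S \<Longrightarrow> D i j \<le> max (D i k) (D k j)"
    and lower: "\<And>i j. i \<in> S \<Longrightarrow> j \<in> S \<Longrightarrow> i \<noteq> j \<Longrightarrow> \<delta> \<le> D i j"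
    and zero: "(\<Sum>i\<in>S. v i) = 0"
  shows "(\<Sum>i\<in>S. \<Sum>j\<in>S. D i j * v i * v j) \<le> - \<delta> * (\<Sum>i\<in>S. (v i)\<^sup>2)"
  using assms
proof (induction "card S" arbitrary: S v \<delta> rule: less_induct)
  case less
  note fin = less.prems(1) and diag = less.prems(2) and sym = less.prems(3)
    and ultra = less.prems(4) and lower = less.prems(5) and zero = less.prems(6)
  show ?case
  proof (cases "\<exists>a\<in>S. \<exists>b\<in>S. a \<noteq> b")
    case False
    then have "S = {} \<or> (\<exists>a. S = {a})" by blast
    then show ?thesis using zero diag by auto
  next
    case True
    (* A closest pair (a, b); the induction hypothesis is used with its distance m in place of \<delta>. *)
    define P where "P = {(a, b) \<in> S \<times> S. a \<noteq> b}"
    have "P \<subseteq> S \<times> S" "P \<noteq> {}" using True by (auto simp: P_def)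
    moreover from this have "finite P" using fin finite_subset by blast
    ultimately obtain q where q: "q \<in> P" "\<And>r. r \<in> P \<Longrightarrow> case_prod D q \<le> case_prod D r"
      by (metis arg_min_if_finite(1) arg_min_least)
    obtain a b where ab: "q = (a, b)" by (cases q)
    define m where "m = D a b"
    have aS: "a \<in> S" and bS: "b \<in> S" and neq: "a \<noteq> b"
      using q ab by (auto simp: P_def)
    have min: "m \<le> D i j" if "i \<in> S" "j \<in> S" "i \<noteq> j" for i j
      using q(2)[of "(i, j)"] that ab by (auto simp: P_def m_def)
    define U where "U = S - {a, b}"
    have U: "finite U" "a \<notin> U" "b \<notin> U" and S: "S = insert a (insert b U)"
      using fin aS bS by (auto simp: U_def)
    have same: "D a k = D b k" if "k \<in> U" for k
    proof -
      have k: "k \<in> S" "k \<noteq> a" "k \<noteq> b" using that by (auto simp: U_def)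
      have "D a k \<le> max (D a b) (D b k)" "D b k \<le> max (D b a) (D a k)"
        using ultra aS bS k by blast+
      moreover have "D a b \<le> D b k" "D b a \<le> D a k"
        using min[of b k] min[of a k] sym[OF aS bS] k aS bS by (auto simp: m_def)
      ultimately show ?thesis by auto
    qed
    (* The vector after the mass of a has been moved to b. *)
    define w where "w = v(b := v a + v b)"
    have wU: "w i = v i" if "i \<in> U" for i using that U by (auto simp: w_def)
    have wb: "w b = v a + v b" by (simp add: w_def)
    let ?T = "insert b U"
    have "(\<Sum>i\<in>?T. \<Sum>j\<in>?T. D i j * w i * w j) \<le> - m * (\<Sum>i\<in>?T. (w i)\<^sup>2)"
    proof (rule less.hyps)
      show "card ?T < card S" using S U neq by simp
      have "(\<Sum>i\<in>?T. w i) = (v a + v b) + (\<Sum>i\<in>U. v i)"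
        using U wU by (simp add: wb cong: sum.cong)
      also have "\<dots> = (\<Sum>i\<in>S. v i)" using S U neq by simp
      finally show "(\<Sum>i\<in>?T. w i) = 0" using zero by simp
    qed (use S U diag sym ultra min in auto)
    moreover have "(\<Sum>i\<in>?T. \<Sum>j\<in>?T. D i j * w i * w j)
        = 2 * (v a + v b) * (\<Sum>k\<in>U. D b k * v k) + (\<Sum>i\<in>U. \<Sum>j\<in>U. D i j * v i * v j)"
    proof -
      have "(\<Sum>i\<in>U. D i b * w i * w b) = (v a + v b) * (\<Sum>k\<in>U. D b k * v k)"
        unfolding sum_distrib_left using sym bS S wU wb by (intro sum.cong) auto
      moreover have "(\<Sum>j\<in>U. D b j * w b * w j) = (v a + v b) * (\<Sum>k\<in>U. D b k * v k)"
        unfolding sum_distrib_left using wU wb by (intro sum.cong) auto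
      moreover have "(\<Sum>i\<in>U. \<Sum>j\<in>U. D i j * w i * w j) = (\<Sum>i\<in>U. \<Sum>j\<in>U. D i j * v i * v j)"
        using wU by (intro sum.cong) auto
      ultimately show ?thesis
        using U diag[OF bS] by (simp add: sum.distrib)
    qed
    moreover have "(\<Sum>i\<in>S. \<Sum>j\<in>S. D i j * v i * v j)
        = 2 * m * v a * v b + 2 * (v a + v b) * (\<Sum>k\<in>U. D b k * v k)
          + (\<Sum>i\<in>U. \<Sum>j\<in>U. D i j * v i * v j)"
    proof -
      have "(\<Sum>i\<in>U. D i a * v i * v a) = v a * (\<Sum>k\<in>U. D b k * v k)"
        unfolding sum_distrib_left using sym aS S same by (intro sum.cong) auto
      moreover have "(\<Sum>j\<in>U. D a j * v a * v j) = v a * (\<Sum>k\<in>U. D b k * v k)"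
        unfolding sum_distrib_left using same by (intro sum.cong) auto
      moreover have "(\<Sum>i\<in>U. D i b * v i * v b) = v b * (\<Sum>k\<in>U. D b k * v k)"
        unfolding sum_distrib_left using sym bS S by (intro sum.cong) auto
      moreover have "(\<Sum>j\<in>U. D b j * v b * v j) = v b * (\<Sum>k\<in>U. D b k * v k)"
        unfolding sum_distrib_left by (intro sum.cong) auto
      moreover have "D b a = m" using sym[OF aS bS] by (simp add: m_def)
      ultimately show ?thesis
        using U neq diag[OF aS] diag[OF bS] S
        by (simp add: sum.distrib m_def[symmetric] algebra_simps)
    qed
    moreover have "(\<Sum>i\<in>?T. (w i)\<^sup>2) = (v a + v b)\<^sup>2 + (\<Sum>i\<in>U. (v i)\<^sup>2)"
      using U wU by (simp add: wb cong: sum.cong)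
    moreover have "(\<Sum>i\<in>S. (v i)\<^sup>2) = (v a)\<^sup>2 + (v b)\<^sup>2 + (\<Sum>i\<in>U. (v i)\<^sup>2)"
      using U neq S by simp
    ultimately have "(\<Sum>i\<in>S. \<Sum>j\<in>S. D i j * v i * v j) \<le> - m * (\<Sum>i\<in>S. (v i)\<^sup>2)"
      by (simp add: power2_eq_square algebra_simps)
    also have "\<dots> \<le> - \<delta> * (\<Sum>i\<in>S. (v i)\<^sup>2)"
      using lower[OF aS bS neq] by (simp add: m_def mult_right_mono sum_nonneg)
    finally show ?thesis .
  qed
qed

section \<open>The spectrum of the Gramian\<close>

text \<open>
  Expanding the Gramian form, the two terms with distances to the base point both give the product of
  \<open>\<Sum>i<n. D (Suc i) 0 * w (Suc i)\<close> and \<open>\<Sum>i<n. w (Suc i) = - w 0\<close>.  They are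
  the row and the column of index \<open>0\<close> in the double sum over all points.
\<close>
lemma double_sum_gramian_form:
  fixes D :: "nat \<Rightarrow> nat \<Rightarrow> real" and w :: "nat \<Rightarrow> real"
  assumes diag: "D 0 0 = 0"
    and sym: "\<And>i. i \<le> n \<Longrightarrow> D i 0 = D 0 i"
    and zero: "(\<Sum>i\<le>n. w i) = 0"
  shows "(\<Sum>i<n. \<Sum>j<n. (D (Suc i) 0 + D (Suc j) 0 - D (Suc i) (Suc j)) / 2 * w (Suc i) * w (Suc j))
    = - (\<Sum>i\<le>n. \<Sum>j\<le>n. D i j * w i * w j) / 2"
proof -
  define s where "s = (\<Sum>i<n. w (Suc i))"
  define t where "t = (\<Sum>i<n. D (Suc i) 0 * w (Suc i))"
  define r where "r = (\<Sum>i<n. \<Sum>j<n. D (Suc i) (Suc j) * w (Suc i) * w (Suc j))"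
  have w0: "w 0 = - s" using zero by (simp add: sum.atMost_shift s_def)
  have "(\<Sum>i<n. \<Sum>j<n. (D (Suc i) 0 + D (Suc j) 0 - D (Suc i) (Suc j)) / 2 * w (Suc i) * w (Suc j))
      = (\<Sum>i<n. \<Sum>j<n. (D (Suc i) 0 * w (Suc i)) * w (Suc j) / 2
          + w (Suc i) * (D (Suc j) 0 * w (Suc j)) / 2
          - D (Suc i) (Suc j) * w (Suc i) * w (Suc j) / 2)"
    by (intro sum.cong refl) (simp add: field_simps)
  also have "\<dots> = t * s / 2 + s * t / 2 - r / 2"
    by (simp add: sum.distrib sum_subtractf s_def t_def r_def sum_product sum_divide_distrib)
  also have "\<dots> = s * t - r / 2" by simp
  finally have lhs: "(\<Sum>i<n. \<Sum>j<n. (D (Suc i) 0 + D (Suc j) 0 - D (Suc i) (Suc j)) / 2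
      * w (Suc i) * w (Suc j)) = s * t - r / 2" .
  have "(\<Sum>j<n. D 0 (Suc j) * w 0 * w (Suc j)) = w 0 * t"
    unfolding t_def sum_distrib_left by (intro sum.cong) (auto simp: sym)
  moreover have "(\<Sum>i<n. D (Suc i) 0 * w (Suc i) * w 0) = w 0 * t"
    unfolding t_def sum_distrib_left by (intro sum.cong) auto
  ultimately have "(\<Sum>i\<le>n. \<Sum>j\<le>n. D i j * w i * w j) = 2 * w 0 * t + r"
    by (simp add: sum.atMost_shift sum.distrib diag r_def)
  then show ?thesis using lhs w0 by simp
qed

lemma gramian_eigenvalue_ge:
  fixes d :: "'a \<Rightarrow> 'a \<Rightarrow> real"
  assumes inj: "inj_on x {..n}"
    and um: "Ultrametric_space (x ` {..n}) d"
    and p: "p > 0"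
    and m: "0 \<le> m" "\<And>y z. y \<in> x ` {..n} \<Longrightarrow> z \<in> x ` {..n} \<Longrightarrow> y \<noteq> z \<Longrightarrow> m \<le> d y z"
    and ev: "eigenvalue (gramian p d n x) k"
  shows "m powr p / 2 \<le> k"
proof -
  interpret Ultrametric_space "x ` {..n}" d by (fact um)
  define D where "D i j = d (x i) (x j) powr p" for i j
  define G where "G = gramian p d n x"
  have G: "G \<in> carrier_mat n n" by (simp add: G_def gramian_def)
  have Gij: "G $$ (i, j) = (D (Suc i) 0 + D (Suc j) 0 - D (Suc i) (Suc j)) / 2"
    if "i < n" "j < n" for i j
    using that by (simp add: G_def gramian_def D_def)
  obtain v where v: "v \<in> carrier_vec n" "v \<noteq> 0\<^sub>v n" "G *\<^sub>v v = k \<cdot>\<^sub>v v"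
    using ev G by (auto simp: eigenvalue_def eigenvector_def G_def[symmetric])
  define w where "w i = (case i of 0 \<Rightarrow> - (\<Sum>i<n. v $ i) | Suc i \<Rightarrow> v $ i)" for i
  have w: "w (Suc i) = v $ i" for i by (simp add: w_def)
  have w_sum: "(\<Sum>i\<le>n. w i) = 0" by (simp add: sum.atMost_shift w_def)
  define N where "N = (\<Sum>i<n. (v $ i)\<^sup>2)"
  have "N > 0"
  proof -
    obtain i where "i < n" "v $ i \<noteq> 0" using v(1,2) by (auto simp: vec_eq_iff)
    then show ?thesis unfolding N_def by (intro sum_pos2[of _ i]) auto
  qed
  have row: "k * v $ i = (\<Sum>j<n. G $$ (i, j) * v $ j)" if "i < n" for i
  proof -
    have "(G *\<^sub>v v) $ i = (\<Sum>j<n. G $$ (i, j) * v $ j)"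
      using that v(1) G by (simp add: scalar_prod_def atLeast0LessThan)
    then show ?thesis using v(1,3) that by simp
  qed
  (* k * N is the value of the Gramian form at the eigenvector v. *)
  have "k * N = (\<Sum>i<n. (k * v $ i) * v $ i)"
    by (simp add: N_def sum_distrib_left power2_eq_square mult.assoc)
  also have "\<dots> = (\<Sum>i<n. \<Sum>j<n. (D (Suc i) 0 + D (Suc j) 0 - D (Suc i) (Suc j)) / 2
      * w (Suc i) * w (Suc j))"
    by (intro sum.cong refl) (auto simp: row Gij w sum_distrib_right intro!: sum.cong)
  also have "\<dots> = - (\<Sum>i\<le>n. \<Sum>j\<le>n. D i j * w i * w j) / 2"
    by (rule double_sum_gramian_form) (use w_sum in \<open>auto simp: D_def commute\<close>)
  finally have kN: "k * N = - (\<Sum>i\<le>n. \<Sum>j\<le>n. D i j * w i * w j) / 2" .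
  have "(\<Sum>i\<le>n. \<Sum>j\<le>n. D i j * w i * w j) \<le> - (m powr p) * (\<Sum>i\<le>n. (w i)\<^sup>2)"
  proof (rule ultrametric_quadratic_form_le)
    fix i j k assume "i \<in> {..n}" "j \<in> {..n}" "k \<in> {..n}"
    then have "d (x i) (x j) \<le> max (d (x i) (x k)) (d (x k) (x j))"
      using ultrametric[of "x i" "x j" "x k"] by (simp add: commute)
    then show "D i j \<le> max (D i k) (D k j)"
      using p by (auto simp: D_def le_max_iff_disj intro: powr_mono2)
  next
    fix i j assume "i \<in> {..n}" "j \<in> {..n}" "i \<noteq> j"
    then show "m powr p \<le> D i j"
      using p m inj by (auto simp: D_def inj_on_def intro!: powr_mono2)
  qed (use w_sum in \<open>auto simp: D_def commute\<close>)
  also have "\<dots> \<le> - (m powr p) * N"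
  proof -
    have "N \<le> (\<Sum>i\<le>n. (w i)\<^sup>2)" by (simp add: sum.atMost_shift w N_def)
    then show ?thesis by (simp add: mult_left_mono)
  qed
  finally have "m powr p / 2 * N \<le> k * N" using kN by simp
  then show ?thesis using \<open>N > 0\<close> by simp
qed

lemma (in Ultrametric_space) closest_pair_same_dist:
  assumes "y \<in> M" "z \<in> M" "u \<in> M" "d y z \<le> d u y" "d y z \<le> d u z"
  shows "d u y = d u z"
  using ultrametric[of u y z] ultrametric[of u z y] assms by (auto simp: commute)

text \<open>
  In the product of the Gramian with \<open>unit_vec n i - unit_vec n j\<close> the distances to the
  base point cancel, and so does each entry outside \<open>{i, j}\<close>, because a third point is
  equally far from both points of a closest pair.
\<close>
lemma closest_pair_gramian_eigenvalue:
  fixes d :: "'a \<Rightarrow> 'a \<Rightarrow> real"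
  assumes inj: "inj_on x {..n}"
    and um: "Ultrametric_space (x ` {..n}) d"
    and p: "p > 0"
    and m: "\<And>y z. y \<in> x ` {..n} \<Longrightarrow> z \<in> x ` {..n} \<Longrightarrow> y \<noteq> z \<Longrightarrow> m \<le> d y z"
    and ij: "i < n" "j < n" "i \<noteq> j" "d (x (Suc i)) (x (Suc j)) = m"
  shows "eigenvalue (gramian p d n x) (m powr p / 2)"
proof -
  interpret Ultrametric_space "x ` {..n}" d by (fact um)
  define G where "G = gramian p d n x"
  have G: "G \<in> carrier_mat n n" by (simp add: G_def gramian_def)
  define v :: "real vec" where "v = unit_vec n i - unit_vec n j"
  have v: "v \<in> carrier_vec n" by (simp add: v_def)
  have "v $ i = 1" using ij by (simp add: v_def)
  then have v0: "v \<noteq> 0\<^sub>v n" using ij by auto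
  have same: "d (x k) (x (Suc i)) = d (x k) (x (Suc j))" if "k \<le> n" "k \<noteq> Suc i" "k \<noteq> Suc j" for k
  proof (rule closest_pair_same_dist)
    have "x k \<noteq> x (Suc i)" "x k \<noteq> x (Suc j)" using that ij inj by (auto simp: inj_on_def)
    then show "d (x (Suc i)) (x (Suc j)) \<le> d (x k) (x (Suc i))"
      "d (x (Suc i)) (x (Suc j)) \<le> d (x k) (x (Suc j))"
      using that ij m by auto
  qed (use that ij in auto)
  have "G *\<^sub>v v = (m powr p / 2) \<cdot>\<^sub>v v"
  proof (rule eq_vecI)
    fix k assume "k < dim_vec ((m powr p / 2) \<cdot>\<^sub>v v)"
    then have k: "k < n" using v by simp
    have "(G *\<^sub>v v) $ k = G $$ (k, i) - G $$ (k, j)"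
      using k ij G by (simp add: v_def scalar_prod_minus_distrib[of _ n])
    (* The base point is itself a third point, so its distances to the pair are equal. *)
    also have "\<dots> = (d (x (Suc k)) (x (Suc j)) powr p - d (x (Suc k)) (x (Suc i)) powr p) / 2"
      using same[of 0] k ij by (simp add: G_def gramian_def commute field_simps)
    also have "\<dots> = (m powr p / 2) * v $ k"
    proof (cases "k = i \<or> k = j")
      case True
      then show ?thesis using ij k by (auto simp: v_def commute)
    next
      case False
      then show ?thesis using same[of "Suc k"] k ij by (simp add: v_def)
    qed
    finally show "(G *\<^sub>v v) $ k = ((m powr p / 2) \<cdot>\<^sub>v v) $ k" using k v by simp
  qed (use G v in auto)
  then show ?thesis
    using v v0 G by (auto simp: eigenvalue_def eigenvector_def G_def[symmetric])
qed

section \<open>Minimum distance and degeneracy\<close>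

context Metric_space
begin

lemma finite_nonzero_dists:
  assumes "finite M"
  shows "finite {d y z | y z. y \<in> M \<and> z \<in> M \<and> d y z \<noteq> 0}"
  by (rule finite_subset[of _ "case_prod d ` (M \<times> M)"]) (use assms in auto)

lemma min_dist_le:
  assumes "finite M" "y \<in> M" "z \<in> M" "y \<noteq> z"
  shows "min_dist M d \<le> d y z"
proof -
  have "d y z \<noteq> 0" using assms by simp
  then have "d y z \<in> {d y z | y z. y \<in> M \<and> z \<in> M \<and> d y z \<noteq> 0}" using assms by blast
  then show ?thesis
    unfolding min_dist_def by (intro Min_le finite_nonzero_dists assms(1))
qed

lemma min_dist_attained:
  assumes "finite M" "a \<in> M" "b \<in> M" "a \<noteq> b"
  obtains y z where "y \<in> M" "z \<in> M" "y \<noteq> z" "d y z = min_dist M d"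
proof -
  have "min_dist M d \<in> {d y z | y z. y \<in> M \<and> z \<in> M \<and> d y z \<noteq> 0}"
    unfolding min_dist_def by (rule Min_in) (use assms finite_nonzero_dists in auto)
  then show ?thesis using that by auto
qed

end

text \<open>
  If all closest pairs contain \<open>b\<close>, there is only one: two points at minimum distance from \<open>b\<close>
  are by the ultrametric inequality at minimum distance from each other, and this pair avoids \<open>b\<close>.
  Every ball whose radius is the minimum distance is therefore that pair or a single point.
\<close>
lemma (in Ultrametric_space) unique_coterie:
  assumes fin: "finite M" and b: "b \<in> M" and ab: "a \<in> M" "a \<noteq> b"
    and none: "\<And>y z. y \<in> M - {b} \<Longrightarrow> z \<in> M - {b} \<Longrightarrow> y \<noteq> z \<Longrightarrow> d y z \<noteq> min_dist M d"
  shows "\<exists>B. {C. coterie M d C} = {B} \<and> card B = 2 \<and> b \<in> B"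
proof -
  define m where "m = min_dist M d"
  have m: "m \<le> d y z" if "y \<in> M" "z \<in> M" "y \<noteq> z" for y z
    using min_dist_le fin that by (simp add: m_def)
  obtain y z where yz: "y \<in> M" "z \<in> M" "y \<noteq> z" "d y z = m"
    using min_dist_attained[OF fin ab(1) b ab(2)] m_def by metis
  then have "m > 0" by (metis mdist_pos_less)
  have "y = b \<or> z = b" using none yz by (auto simp: m_def)
  then obtain c where c: "c \<in> M" "c \<noteq> b" "d b c = m"
    using yz by (auto simp: commute)
  have close: "{y, z} = {b, c}" if "y \<in> M" "z \<in> M" "y \<noteq> z" "d y z \<le> m" for y z
  proof -
    have other: "e = c" if "e \<in> M" "e \<noteq> b" "d b e \<le> m" for e
    proof (rule ccontr)
      assume "e \<noteq> c"
      then have "d e c = m"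
        using ultrametric[of e c b] m[of e c] that c b by (auto simp: commute)
      then show False using none[of e c] that c \<open>e \<noteq> c\<close> by (simp add: m_def)
    qed
    have "d y z = m" using m that by force
    then have "y = b \<or> z = b" using none that by (auto simp: m_def)
    then show ?thesis using other[of y] other[of z] that by (auto simp: commute)
  qed
  have ball: "mcball z m = (if z \<in> {b, c} then {b, c} else {z})" if "z \<in> M" for z
  proof -
    have "e \<in> (if z \<in> {b, c} then {b, c} else {z})" if "e \<in> mcball z m" for e
    proof (cases "e = z")
      case False
      then have "{z, e} = {b, c}" using close[of z e] that by (auto simp: in_mcball)
      then show ?thesis by auto
    qed auto
    moreover have "{b, c} \<subseteq> mcball z m" if "z \<in> {b, c}"
      using that \<open>m > 0\<close> b c by (auto simp: in_mcball commute)
    moreover have "z \<in> mcball z m" using that \<open>m > 0\<close> by (simp add: in_mcball)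
    ultimately show ?thesis by (intro equalityI subsetI) (auto simp del: in_mcball split: if_splits)
  qed
  have "coterie M d C \<longleftrightarrow> C = {b, c}" for C
  proof -
    have "card {b, c} = 2" using c by simp
    then show ?thesis
      unfolding coterie_def m_def[symmetric] using ball b by (auto split: if_splits)
  qed
  then show ?thesis using c by (intro exI[of _ "{b, c}"]) auto
qed

theorem corollary4p6:
  fixes d :: "'a \<Rightarrow> 'a \<Rightarrow> real" and x :: "nat \<Rightarrow> 'a" and n :: nat and p :: real
  assumes "inj_on x {..n}"
    and "n + 1 \<ge> 3"
    and "Ultrametric_space (x ` {..n}) d"
    and "\<not> degenerate d n x"
    and "p > 0"
  shows "min_eigenvalue (gramian p d n x) = min_dist (x ` {..n}) d powr p / 2"
proof -
  interpret Ultrametric_space "x ` {..n}" d by (fact assms(3))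
  define m where "m = min_dist (x ` {..n}) d"
  have m_le: "m \<le> d y z" if "y \<in> x ` {..n}" "z \<in> x ` {..n}" "y \<noteq> z" for y z
    using min_dist_le that by (simp add: m_def)
  have x10: "x 1 \<in> x ` {..n}" "x 0 \<in> x ` {..n}" "x 1 \<noteq> x 0"
    using assms(1,2) by (auto simp: inj_on_def)
  have "0 \<le> m"
    using min_dist_attained[OF _ x10] m_def by (metis finite_atMost finite_imageI nonneg)
  (* Nondegeneracy enters here only: some closest pair avoids the base point. *)
  obtain y z where yz: "y \<in> x ` {..n} - {x 0}" "z \<in> x ` {..n} - {x 0}" "y \<noteq> z" "d y z = m"
    using unique_coterie[OF _ x10(2,1,3)] assms(4) unfolding degenerate_def m_def by auto
  obtain i' j' where "y = x i'" "i' \<le> n" "z = x j'" "j' \<le> n" using yz by auto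
  moreover from this have "i' \<noteq> 0" "j' \<noteq> 0" using yz(1,2) by (metis DiffD2 singletonI)+
  ultimately obtain i j where ij: "y = x (Suc i)" "i < n" "z = x (Suc j)" "j < n"
    by (metis Suc_le_eq not0_implies_Suc)
  have "eigenvalue (gramian p d n x) (m powr p / 2)"
    using closest_pair_gramian_eigenvalue[OF assms(1,3,5) m_le, of i j] ij yz by auto
  moreover have "m powr p / 2 \<le> k" if "eigenvalue (gramian p d n x) k" for k
    using gramian_eigenvalue_ge[OF assms(1,3,5) \<open>0 \<le> m\<close> m_le that] .
  moreover have "finite (spectrum (gramian p d n x))"
    by (rule card_finite_spectrum(1)[of _ n]) (simp add: gramian_def)
  ultimately show ?thesis
    unfolding min_eigenvalue_def m_def[symmetric]
    by (intro Min_eqI) (auto simp: spectrum_def)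
qed

end
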